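(* Let $S$ and $T$ be numerical semigroups. If the posets $(\operatorname{G}(S),\le_S)$ and $(\operatorname{G}(T),\le_T)$ are isomorphic, then $S=T$.
   Context: $\mathbb{N}$ denotes the set of non-negative integers. A numerical semigroup $S$ is a submonoid of $(\mathbb{N},+)$ such that $\mathbb{N}\setminus S$ is finite. The gap set of $S$ is $\operatorname{G}(S)=\mathbb{N}\setminus S$. The order induced by $S$ on the integers is defined by $a\le_S b$ if $b-a\in S$. Two posets $(P,\le_P)$ and $(Q,\le_Q)$ are isomorphic if there is a bijection $f:P\to Q$ such that for all $a,b\in P$, $a\le_P b$ if and only if $f(a)\le_Q f(b)$. *)

theory Defs
  imports Main
begin

definition numerical_semigroup :: "nat set \<Rightarrow> bool" where
  "numerical_semigroup S \<longleftrightarrow>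
     0 \<in> S \<and> (\<forall>a\<in>S. \<forall>b\<in>S. a + b \<in> S) \<and> finite (UNIV - S)"

definition gaps :: "nat set \<Rightarrow> nat set" where
  "gaps S = UNIV - S"

(* The difference is taken in the integers: truncated subtraction on nat would yield 0 \<in> S
   whenever b < a. *)
definition semigroup_le :: "nat set \<Rightarrow> int \<Rightarrow> int \<Rightarrow> bool" where
  "semigroup_le S a b \<longleftrightarrow> b - a \<in> int ` S"

definition gap_le :: "nat set \<Rightarrow> nat \<Rightarrow> nat \<Rightarrow> bool" where
  "gap_le S a b \<longleftrightarrow> semigroup_le S (int a) (int b)"

(* A poset is given by its carrier set and its order; the order is only used on the carrier. *)
definition poset_isomorphic ::
    "'a set \<Rightarrow> ('a \<Rightarrow> 'a \<Rightarrow> bool) \<Rightarrow> 'b set \<Rightarrow> ('b \<Rightarrow> 'b \<Rightarrow> bool) \<Rightarrow> bool" where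
  "poset_isomorphic P le_P Q le_Q \<longleftrightarrow>
     (\<exists>f. bij_betw f P Q \<and> (\<forall>a\<in>P. \<forall>b\<in>P. le_P a b \<longleftrightarrow> le_Q (f a) (f b)))"

end

theory Submission
  imports Defs
begin

text \<open>For a gap \<open>g\<close> of \<open>S\<close>, the map \<open>s \<mapsto> g - s\<close> is a bijection from
  \<open>S \<inter> [0, g]\<close> onto the elements below \<open>g\<close> in the gap poset: were \<open>g - s\<close> in \<open>S\<close>, so would be
  \<open>g\<close>. Hence the poset determines, for every \<open>k\<close>, how many gaps have exactly \<open>k\<close> elements of \<open>S\<close>
  below them, i.e. how many gaps lie between consecutive elements of \<open>S\<close>, and these numbers
  determine \<open>S\<close>.\<close>

lemma gap_le_iff: "gap_le S a b \<longleftrightarrow> a \<le> b \<and> b - a \<in> S"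
proof
  assume "gap_le S a b"
  then obtain s where "s \<in> S" "int b - int a = int s"
    by (auto simp: gap_le_def semigroup_le_def)
  moreover from this have "a \<le> b" "b - a = s" by linarith+
  ultimately show "a \<le> b \<and> b - a \<in> S" by simp
next
  assume "a \<le> b \<and> b - a \<in> S"
  then show "gap_le S a b"
    unfolding gap_le_def semigroup_le_def by (metis image_eqI of_nat_diff)
qed

lemma card_gap_downset:
  assumes "numerical_semigroup S" and "g \<in> gaps S"
  shows "card {h \<in> gaps S. gap_le S h g} = card (S \<inter> {..g})"
proof -
  have "g - s \<notin> S" if "s \<in> S" "s \<le> g" for s
  proof
    assume "g - s \<in> S"
    then have "s + (g - s) \<in> S" using that assms(1) unfolding numerical_semigroup_def by blast
    with \<open>s \<le> g\<close> assms(2) show False by (simp add: gaps_def)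
  qed
  then have "bij_betw (\<lambda>h. g - h) {h \<in> gaps S. gap_le S h g} (S \<inter> {..g})"
    by (intro bij_betw_byWitness[where f' = "\<lambda>s. g - s"]) (auto simp: gap_le_iff gaps_def)
  then show ?thesis by (rule bij_betw_same_card)
qed

lemma card_downset_bij:
  assumes f: "bij_betw f P Q" and le: "\<forall>a\<in>P. \<forall>b\<in>P. le_P a b \<longleftrightarrow> le_Q (f a) (f b)"
    and "g \<in> P"
  shows "card {h \<in> P. le_P h g} = card {h \<in> Q. le_Q h (f g)}"
proof -
  have "f ` {h \<in> P. le_P h g} = {h \<in> Q. le_Q h (f g)}"
    using le \<open>g \<in> P\<close> bij_betw_imp_surj_on[OF f] by auto
  then have "bij_betw f {h \<in> P. le_P h g} {h \<in> Q. le_Q h (f g)}"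
    by (intro bij_betw_subset[OF f]) auto
  then show ?thesis by (rule bij_betw_same_card)
qed

text \<open>For a numerical semigroup and \<open>k > 0\<close>, this is the run of gaps strictly
  between the \<open>k\<close>-th element of \<open>S\<close> and the next one; it may be
  empty.\<close>

definition level :: "nat set \<Rightarrow> nat \<Rightarrow> nat set" where
  "level S k = {g \<in> gaps S. card (S \<inter> {..g}) = k}"

text \<open>In \<open>S\<close> the element \<open>n\<close> ends a run of gaps; were
  \<open>n\<close> missing from \<open>T\<close>, the same run would continue in \<open>T\<close>
  through \<open>n\<close>, giving a strictly larger finite level.\<close>

lemma mem_of_card_level_eq:
  assumes fin: "finite (gaps T)"
    and lev: "\<And>k. card (level S k) = card (level T k)"
    and agree: "S \<inter> {..<n} = T \<inter> {..<n}" and "n \<in> S"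
  shows "n \<in> T"
proof (rule ccontr)
  assume "n \<notin> T"
  \<comment> \<open>As \<open>T\<close> agrees with \<open>S\<close> below \<open>n\<close>, this is
    the level that \<open>n\<close> would have as a gap of \<open>T\<close>.\<close>
  define k where "k = card (S \<inter> {..<n})"
  have below: "g < n" if "g \<in> level S k" for g
  proof (rule ccontr)
    assume "\<not> g < n"
    \<comment> \<open>From \<open>n\<close> onwards the count for \<open>S\<close> includes
      \<open>n\<close> itself and so exceeds \<open>k\<close>.\<close>
    then have "insert n (S \<inter> {..<n}) \<subseteq> S \<inter> {..g}" using \<open>n \<in> S\<close> by auto
    then have "card (insert n (S \<inter> {..<n})) \<le> card (S \<inter> {..g})" by (intro card_mono) auto
    with that show False by (simp add: k_def level_def)
  qed
  have "g \<in> level T k" if "g \<in> level S k" for g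
  proof -
    have eq: "x \<in> S \<longleftrightarrow> x \<in> T" if "x \<le> g" for x
    proof -
      have "x \<in> {..<n}" using that below[OF \<open>g \<in> level S k\<close>] by simp
      with agree show ?thesis by blast
    qed
    then have "S \<inter> {..g} = T \<inter> {..g}" by auto
    with that eq[of g] show ?thesis by (simp add: level_def gaps_def)
  qed
  moreover have "T \<inter> {..n} = T \<inter> {..<n}" using \<open>n \<notin> T\<close> by (auto simp: order_le_less)
  then have "n \<in> level T k" using \<open>n \<notin> T\<close> agree by (simp add: level_def gaps_def k_def)
  moreover have "n \<notin> level S k" using below by blast
  ultimately have "level S k \<subset> level T k" by blast
  moreover have "finite (level T k)" using fin by (simp add: level_def)
  ultimately have "card (level S k) < card (level T k)" by (intro psubset_card_mono)
  with lev[of k] show False by simp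
qed

lemma eq_of_card_level_eq:
  assumes "finite (gaps S)" "finite (gaps T)"
    and "\<And>k. card (level S k) = card (level T k)"
  shows "S = T"
proof -
  have "n \<in> S \<longleftrightarrow> n \<in> T" for n
  proof (induction n rule: less_induct)
    case (less n)
    then have "S \<inter> {..<n} = T \<inter> {..<n}" by auto
    then show ?case
      \<comment> \<open>Each instance gives one implication; the hypotheses are symmetric in
        \<open>S\<close> and \<open>T\<close>.\<close>
      using mem_of_card_level_eq[of T S n] mem_of_card_level_eq[of S T n] assms by auto
  qed
  then show ?thesis by blast
qed

theorem corollary5:
  fixes S T :: "nat set"
  assumes "numerical_semigroup S"
    and "numerical_semigroup T"
    and "poset_isomorphic (gaps S) (gap_le S) (gaps T) (gap_le T)"
  shows "S = T"
proof (rule eq_of_card_level_eq)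
  show "finite (gaps S)" "finite (gaps T)"
    using assms(1,2) by (simp_all add: numerical_semigroup_def gaps_def)
  obtain f where f: "bij_betw f (gaps S) (gaps T)"
    and le: "\<forall>a\<in>gaps S. \<forall>b\<in>gaps S. gap_le S a b \<longleftrightarrow> gap_le T (f a) (f b)"
    using assms(3) by (auto simp: poset_isomorphic_def)
  \<comment> \<open>Both counts are sizes of down-sets in the gap posets, which \<open>f\<close>
    preserves.\<close>
  have card_eq: "card (S \<inter> {..g}) = card (T \<inter> {..f g})" if "g \<in> gaps S" for g
    using card_downset_bij[OF f le that] card_gap_downset[OF assms(1) that]
      card_gap_downset[OF assms(2) bij_betwE[OF f, rule_format, OF that]] by simp
  show "card (level S k) = card (level T k)" for k
  proof -
    have "f ` level S k = level T k"
      \<comment> \<open>Once \<open>gaps T\<close> is rewritten as the image of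
        \<open>gaps S\<close> under \<open>f\<close>, only \<open>card_eq\<close> is needed.\<close>
      unfolding level_def bij_betw_imp_surj_on[OF f, symmetric] using card_eq by auto
    moreover have "level S k \<subseteq> gaps S" by (auto simp: level_def)
    ultimately have "bij_betw f (level S k) (level T k)" using f by (blast intro: bij_betw_subset)
    then show ?thesis by (rule bij_betw_same_card)
  qed
qed

end
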